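(* Let $\mathcal{A}$ be a Leibniz algebra over a field $F$ of characteristic zero and let $S$ be a solvable subinvariant subalgebra of $\mathcal{A}$. Then $S \subseteq R$, where $R = \mathrm{rad}(\mathcal{A})$.
   Context: A Leibniz algebra over a field $F$ means a finite-dimensional left Leibniz algebra: a finite-dimensional $F$-vector space with a bilinear product $(x,y)\mapsto xy$ such that $x(yz) = (xy)z + y(xz)$ for all $x,y,z$. Ideals are two-sided; $I \vartriangleleft J$ means $I$ is an ideal of $J$. For subspaces $X,Y$, $XY$ denotes the linear span of all products $xy$, $x\in X$, $y\in Y$. Set $\mathcal{A}^{(1)} = \mathcal{A}$ and $\mathcal{A}^{(i)} = \mathcal{A}^{(i-1)}\mathcal{A}^{(i-1)}$ for $i \ge 2$; $\mathcal{A}$ is solvable if $\mathcal{A}^{(m)} = \{0\}$ for some positive integer $m$. The maximal solvable ideal of $\mathcal{A}$ is the radical $\mathrm{rad}(\mathcal{A})$. A subalgebra $B$ of $\mathcal{A}$ is subinvariant in $\mathcal{A}$ if there is a chain of subalgebras $B = B_t \subset B_{t-1} \subset \cdots \subset B_0 = \mathcal{A}$ with $B_i \vartriangleleft B_{i-1}$ for all $1 \leq i \leq t$. *)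

theory Defs
  imports Complex_Main
begin

(* The algebra is the whole type 'a; subalgebras and ideals are subsets of it.
   Neither associativity nor a unit is assumed, so the product is a locale parameter. *)
locale leibniz_algebra = vector_space scale
  for scale :: "'f::field \<Rightarrow> 'a::ab_group_add \<Rightarrow> 'a" +
  fixes mult :: "'a \<Rightarrow> 'a \<Rightarrow> 'a"  (infixl "\<bullet>" 70)
  assumes finite_dim: "\<exists>B. finite B \<and> span B = UNIV"
    and linear_left: "\<And>y. Vector_Spaces.linear scale scale (\<lambda>x. x \<bullet> y)"
    and linear_right: "\<And>x. Vector_Spaces.linear scale scale (\<lambda>y. x \<bullet> y)"
    and leibniz: "\<And>x y z. x \<bullet> (y \<bullet> z) = (x \<bullet> y) \<bullet> z + y \<bullet> (x \<bullet> z)"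
begin

definition subalgebra :: "'a set \<Rightarrow> bool" where
  "subalgebra B \<longleftrightarrow> subspace B \<and> (\<forall>x\<in>B. \<forall>y\<in>B. x \<bullet> y \<in> B)"

definition ideal_of :: "'a set \<Rightarrow> 'a set \<Rightarrow> bool" where
  "ideal_of I J \<longleftrightarrow>
     subspace I \<and> I \<subseteq> J \<and> (\<forall>x\<in>I. \<forall>y\<in>J. x \<bullet> y \<in> I \<and> y \<bullet> x \<in> I)"

definition product_space :: "'a set \<Rightarrow> 'a set \<Rightarrow> 'a set" where
  "product_space X Y = span {x \<bullet> y | x y. x \<in> X \<and> y \<in> Y}"

(* Index shift: derived_series X n is the term usually written X^(n+1), where X^(1) = X. *)
primrec derived_series :: "'a set \<Rightarrow> nat \<Rightarrow> 'a set" where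
  "derived_series X 0 = X"
| "derived_series X (Suc n) = product_space (derived_series X n) (derived_series X n)"

definition solvable :: "'a set \<Rightarrow> bool" where
  "solvable X \<longleftrightarrow> (\<exists>n. derived_series X n = {0})"

definition maximal_solvable_ideal :: "'a set \<Rightarrow> bool" where
  "maximal_solvable_ideal R \<longleftrightarrow>
     ideal_of R UNIV \<and> solvable R \<and>
     (\<forall>J. ideal_of J UNIV \<and> solvable J \<and> R \<subseteq> J \<longrightarrow> J = R)"

(* Maximality is with respect to inclusion; the definite description is meaningful because
   the sum of two solvable ideals is solvable, so a maximal one is unique. *)
definition rad :: "'a set" where
  "rad = (THE R. maximal_solvable_ideal R)"

(* Inclusions in the chain need not be strict (repetitions can always be dropped), and
   the chain may have length 0, so the algebra is subinvariant in itself. *)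
definition subinvariant :: "'a set \<Rightarrow> bool" where
  "subinvariant B \<longleftrightarrow>
     (\<exists>(t::nat) C. C t = B \<and> C 0 = UNIV \<and> (\<forall>i\<le>t. subalgebra (C i)) \<and>
        (\<forall>i\<in>{1..t}. ideal_of (C i) (C (i - 1))))"

end

end

theory Submission
  imports Defs
begin

text \<open>
  Let \<open>L\<close> be an ideal of \<open>M\<close>, and let \<open>R\<close> be a maximal solvable ideal of \<open>L\<close>. It suffices that \<open>R\<close>
  is an ideal of \<open>M\<close>, since one can then climb the subinvariant chain. Left multiplication by an
  element of \<open>M\<close> is a derivation \<open>D\<close> of \<open>L\<close>, and \<open>R + D R\<close> is again a solvable ideal of \<open>L\<close>: if \<open>w\<close>
  is a product of \<open>m = 2\<^sup>n\<close> elements of \<open>R\<close>, bracketed as in the derived series, then modulo \<open>R\<close> the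
  Leibniz rule leaves of \<open>D\<^sup>m w\<close> only \<open>m!\<close> times the same product of the derivatives of the factors.
  So once the derived series of \<open>R\<close> has reached zero, that of \<open>R + D R\<close> has entered \<open>R\<close>. Hence
  \<open>D R \<subseteq> R\<close> by maximality. For right multiplications, \<open>xy + yx\<close> annihilates everything from the
  left, and the elements of \<open>L\<close> with this property form an ideal with zero multiplication, which
  lies in \<open>R\<close>.
\<close>

context leibniz_algebra
begin

section \<open>Bilinearity, ideals and product spaces\<close>

lemma mult_add_left: "(x + y) \<bullet> z = x \<bullet> z + y \<bullet> z"
  and mult_scale_left: "scale c x \<bullet> z = scale c (x \<bullet> z)"
  and mult_add_right: "z \<bullet> (x + y) = z \<bullet> x + z \<bullet> y"
  and mult_scale_right: "z \<bullet> scale c x = scale c (z \<bullet> x)"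
  using linear_left[of z] linear_right[of z]
  by (simp_all add: Vector_Spaces.linear_iff)

lemma mult_zero_left [simp]: "0 \<bullet> x = 0"
  using mult_scale_left[of 0 0 x] by simp

lemma mult_diff_left: "(x - y) \<bullet> z = x \<bullet> z - y \<bullet> z"
  by (metis mult_add_left add_diff_cancel_right' diff_add_cancel)

lemma mult_diff_right: "z \<bullet> (x - y) = z \<bullet> x - z \<bullet> y"
  by (metis mult_add_right add_diff_cancel_right' diff_add_cancel)

lemma ideal_of_subspace: "ideal_of I L \<Longrightarrow> subspace I"
  and ideal_of_subset: "ideal_of I L \<Longrightarrow> I \<subseteq> L"
  and ideal_of_mult_right: "ideal_of I L \<Longrightarrow> x \<in> I \<Longrightarrow> y \<in> L \<Longrightarrow> x \<bullet> y \<in> I"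
  and ideal_of_mult_left: "ideal_of I L \<Longrightarrow> x \<in> I \<Longrightarrow> y \<in> L \<Longrightarrow> y \<bullet> x \<in> I"
  by (auto simp: ideal_of_def)

lemma mult_in_product_space: "x \<in> X \<Longrightarrow> y \<in> Y \<Longrightarrow> x \<bullet> y \<in> product_space X Y"
  unfolding product_space_def by (rule span_base) blast

lemma product_space_minimal:
  assumes "subspace W" "\<And>x y. x \<in> X \<Longrightarrow> y \<in> Y \<Longrightarrow> x \<bullet> y \<in> W"
  shows "product_space X Y \<subseteq> W"
  unfolding product_space_def by (rule span_minimal) (use assms in auto)

lemma subspace_product_space: "subspace (product_space X Y)"
  unfolding product_space_def by (rule subspace_span)

section \<open>Derived series and solvability\<close>

lemma subspace_derived_series: "subspace X \<Longrightarrow> subspace (derived_series X n)"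
  by (cases n) (simp_all add: subspace_product_space)

lemma derived_series_mono: "X \<subseteq> Y \<Longrightarrow> derived_series X n \<subseteq> derived_series Y n"
proof (induction n)
  case (Suc n)
  then show ?case
    unfolding derived_series.simps
    by (intro product_space_minimal subspace_product_space mult_in_product_space) auto
qed simp

lemma derived_series_add: "derived_series X (m + n) = derived_series (derived_series X m) n"
  by (induction n) simp_all

lemma solvable_extension:
  assumes "subspace X" "solvable I" "derived_series X m \<subseteq> I"
  shows "solvable X"
proof -
  obtain n where n: "derived_series I n = {0}"
    using assms(2) by (auto simp: solvable_def)
  have "derived_series X (m + n) \<subseteq> {0}"
    using derived_series_mono[OF assms(3), of n] n by (simp add: derived_series_add)
  moreover have "0 \<in> derived_series X (m + n)"
    by (intro subspace_0 subspace_derived_series assms(1))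
  ultimately show ?thesis
    by (auto simp: solvable_def)
qed

section \<open>Sums of solvable ideals\<close>

lemma ideal_of_sum:
  assumes "ideal_of I L" "ideal_of J L" "subspace L"
  shows "ideal_of {x + y | x y. x \<in> I \<and> y \<in> J} L"
  unfolding ideal_of_def
proof (intro conjI ballI)
  show "subspace {x + y | x y. x \<in> I \<and> y \<in> J}"
    using assms by (intro subspace_sums ideal_of_subspace)
  show "{x + y | x y. x \<in> I \<and> y \<in> J} \<subseteq> L"
    using assms by (auto intro!: subspace_add dest: ideal_of_subset)
next
  fix s z assume "s \<in> {x + y | x y. x \<in> I \<and> y \<in> J}" and z: "z \<in> L"
  then obtain x y where s: "s = x + y" "x \<in> I" "y \<in> J"
    by blast
  show "s \<bullet> z \<in> {x + y | x y. x \<in> I \<and> y \<in> J}"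
    unfolding s mult_add_left
    using assms s z by (blast intro: ideal_of_mult_right)
  show "z \<bullet> s \<in> {x + y | x y. x \<in> I \<and> y \<in> J}"
    unfolding s mult_add_right
    using assms s z by (blast intro: ideal_of_mult_left)
qed

text \<open>Modulo \<open>I\<close>, the derived series of \<open>I + J\<close> is that of
  \<open>J\<close>; once the latter vanishes, the former lies in the solvable ideal
  \<open>I\<close>.\<close>

lemma solvable_sum:
  assumes I: "ideal_of I L" and J: "ideal_of J L" and L: "subspace L"
    and "solvable I" "solvable J"
  shows "solvable {x + y | x y. x \<in> I \<and> y \<in> J}"
proof -
  let ?S = "\<lambda>J. {x + y | x y. x \<in> I \<and> y \<in> J}"
  \<comment> \<open>The second conjunct keeps the terms of the series of \<open>J\<close> inside
    \<open>L\<close>, where they may multiply elements of \<open>I\<close>.\<close>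
  have *: "derived_series (?S J) n \<subseteq> ?S (derived_series J n) \<and> derived_series J n \<subseteq> J" for n
  proof (induction n)
    case (Suc n)
    let ?J = "derived_series J n"
    have "derived_series (?S J) (Suc n) \<subseteq> ?S (derived_series J (Suc n))"
      unfolding derived_series.simps
    proof (rule product_space_minimal)
      show "subspace (?S (product_space ?J ?J))"
        by (intro subspace_sums ideal_of_subspace[OF I] subspace_product_space)
      fix s t assume "s \<in> derived_series (?S J) n" "t \<in> derived_series (?S J) n"
      then obtain x y x' y' where st: "s = x + y" "t = x' + y'"
        and x: "x \<in> I" "x' \<in> I" and y: "y \<in> ?J" "y' \<in> ?J"
        using Suc by blast
      have yL: "y \<in> L" "y' \<in> L"
        using y Suc ideal_of_subset[OF J] by blast+
      \<comment> \<open>Of the four products in \<open>s \<bullet> t\<close>, only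
        \<open>y \<bullet> y'\<close> has no factor in \<open>I\<close>.\<close>
      have "x \<bullet> (x' + y') + y \<bullet> x' \<in> I"
        using x yL ideal_of_subset[OF I] L
        by (intro subspace_add ideal_of_subspace[OF I] ideal_of_mult_right[OF I]
            ideal_of_mult_left[OF I]) auto
      moreover have "s \<bullet> t = (x \<bullet> (x' + y') + y \<bullet> x') + y \<bullet> y'"
        by (simp add: st mult_add_left mult_add_right)
      ultimately show "s \<bullet> t \<in> ?S (product_space ?J ?J)"
        using y mult_in_product_space by blast
    qed
    moreover have "derived_series J (Suc n) \<subseteq> J"
      unfolding derived_series.simps
      using Suc ideal_of_subset[OF J]
      by (intro product_space_minimal ideal_of_subspace[OF J] ideal_of_mult_right[OF J]) auto
    ultimately show ?case
      by blast
  qed auto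
  obtain n where "derived_series J n = {0}"
    using assms by (auto simp: solvable_def)
  then have n: "derived_series (?S J) n \<subseteq> I"
    using *[of n] by auto
  have "subspace (?S J)"
    by (intro subspace_sums ideal_of_subspace[OF I] ideal_of_subspace[OF J])
  then show ?thesis
    by (rule solvable_extension[OF _ \<open>solvable I\<close> n])
qed

section \<open>Maximal solvable ideals and the radical\<close>

lemma exists_maximal_solvable_ideal:
  assumes "ideal_of I L" "solvable I"
  obtains R where "ideal_of R L" "solvable R" "I \<subseteq> R"
    "\<And>J. ideal_of J L \<Longrightarrow> solvable J \<Longrightarrow> R \<subseteq> J \<Longrightarrow> J = R"
proof -
  obtain B0 where B0: "finite B0" "span B0 = UNIV"
    using finite_dim by blast
  obtain B where B: "B \<subseteq> B0" "independent B" "B0 \<subseteq> span B"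
    using maximal_independent_subset[of B0] by blast
  have "span B = UNIV"
    using B B0 span_minimal[of B0 "span B"] subspace_span by auto
  then interpret finite_dimensional_vector_space scale B
    using B B0 finite_subset by unfold_locales auto
  let ?P = "\<lambda>R. ideal_of R L \<and> solvable R \<and> I \<subseteq> R"
  have "?P I"
    using assms by blast
  \<comment> \<open>Dimensions are bounded, so some candidate has greatest dimension; a larger
    candidate has equal dimension and hence coincides with it.\<close>
  moreover have "\<forall>R. ?P R \<longrightarrow> dim R < Suc (dim UNIV)"
    using dim_subset[OF subset_UNIV] le_imp_less_Suc by blast
  ultimately obtain R where R: "?P R" "\<And>J. ?P J \<Longrightarrow> dim J \<le> dim R"
    using ex_has_greatest_nat[of ?P I dim "Suc (dim UNIV)"] by blast
  show thesis
  proof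
    fix J assume "ideal_of J L" "solvable J" "R \<subseteq> J"
    then show "J = R"
      using R subspace_dim_equal[of R J] by (auto dest: ideal_of_subspace)
  qed (use R in auto)
qed

text \<open>\<open>R + J\<close> is a solvable ideal above \<open>R\<close>, so maximality makes it
  equal to \<open>R\<close>. Thus a maximal solvable ideal is the greatest one.\<close>

lemma maximal_solvable_ideal_contains:
  assumes "ideal_of R L" "solvable R" "subspace L"
    and max: "\<And>J. ideal_of J L \<Longrightarrow> solvable J \<Longrightarrow> R \<subseteq> J \<Longrightarrow> J = R"
    and "ideal_of J L" "solvable J"
  shows "J \<subseteq> R"
proof -
  let ?S = "{x + y | x y. x \<in> R \<and> y \<in> J}"
  have "0 \<in> R" "0 \<in> J"
    using assms by (auto intro: subspace_0 ideal_of_subspace)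
  then have "R \<subseteq> ?S" "J \<subseteq> ?S"
    by force+
  moreover from this(1) have "?S = R"
    using assms by (intro max ideal_of_sum solvable_sum)
  ultimately show ?thesis
    by simp
qed

text \<open>As \<open>rad\<close> is a definite description, existence and uniqueness must be
  settled first; uniqueness follows because maximal solvable ideals are greatest.\<close>

lemma solvable_ideal_subset_rad:
  assumes "ideal_of I UNIV" "solvable I"
  shows "I \<subseteq> rad"
proof -
  obtain R where R: "ideal_of R UNIV" "solvable R"
    "\<And>J. ideal_of J UNIV \<Longrightarrow> solvable J \<Longrightarrow> R \<subseteq> J \<Longrightarrow> J = R"
    using exists_maximal_solvable_ideal[OF assms] by metis
  note sub = maximal_solvable_ideal_contains[OF R(1,2) subspace_UNIV R(3)]
  have "rad = R"
    unfolding rad_def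
  proof (rule the_equality)
    show "maximal_solvable_ideal R"
      using R unfolding maximal_solvable_ideal_def by blast
    show "Q = R" if "maximal_solvable_ideal Q" for Q
      using that R sub unfolding maximal_solvable_ideal_def by metis
  qed
  then show ?thesis
    using sub assms by blast
qed

section \<open>Derivations of a subspace and the Leibniz rule\<close>

definition derivation_on :: "'a set \<Rightarrow> ('a \<Rightarrow> 'a) \<Rightarrow> bool" where
  "derivation_on L D \<longleftrightarrow> Vector_Spaces.linear scale scale D \<and> D ` L \<subseteq> L \<and>
     (\<forall>x\<in>L. \<forall>y\<in>L. D (x \<bullet> y) = D x \<bullet> y + x \<bullet> D y)"

lemma derivation_on_funpow_closed:
  "derivation_on L D \<Longrightarrow> x \<in> L \<Longrightarrow> (D ^^ k) x \<in> L"
  by (induction k) (auto simp: derivation_on_def)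

lemma linear_funpow:
  assumes "Vector_Spaces.linear scale scale D"
  shows "Vector_Spaces.linear scale scale (D ^^ k)"
  using assms by (induction k) (auto simp: Vector_Spaces.linear_iff)

lemma derivation_on_funpow_mult:
  assumes D: "derivation_on L D" and u: "u \<in> L" and v: "v \<in> L"
  shows "(D ^^ n) (u \<bullet> v) =
    (\<Sum>k\<le>n. scale (of_nat (n choose k)) ((D ^^ k) u \<bullet> (D ^^ (n - k)) v))"
proof (induction n)
  case (Suc n)
  interpret D: Vector_Spaces.linear scale scale D
    using D by (simp add: derivation_on_def)
  let ?p = "\<lambda>i j. (D ^^ i) u \<bullet> (D ^^ j) v"
  have step: "D (?p i j) = ?p (Suc i) j + ?p i (Suc j)" for i j
    using D derivation_on_funpow_closed[OF D] u v by (simp add: derivation_on_def)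
  have "(D ^^ Suc n) (u \<bullet> v) = (\<Sum>k\<le>n. scale (of_nat (n choose k)) (?p (Suc k) (n - k)))
      + (\<Sum>k\<le>n. scale (of_nat (n choose k)) (?p k (Suc n - k)))"
    by (simp add: Suc D.sum D.scale step scale_right_distrib sum.distrib Suc_diff_le
        del: funpow.simps) (simp add: Suc D.sum D.scale step scale_right_distrib sum.distrib)
  \<comment> \<open>The added term \<open>k = Suc n\<close> has coefficient zero. Splitting off
    \<open>k = 0\<close> then aligns both sums for Pascal's rule.\<close>
  also have "(\<Sum>k\<le>n. scale (of_nat (n choose k)) (?p k (Suc n - k))) =
      (\<Sum>k\<le>Suc n. scale (of_nat (n choose k)) (?p k (Suc n - k)))"
    by (simp add: binomial_eq_0)
  also have "\<dots> = ?p 0 (Suc n) +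
      (\<Sum>k\<le>n. scale (of_nat (n choose Suc k)) (?p (Suc k) (n - k)))"
    by (subst sum.atMost_Suc_shift) simp
  finally show ?case
    by (subst sum.atMost_Suc_shift)
      (simp add: scale_left_distrib sum.distrib algebra_simps del: funpow.simps)
qed simp

text \<open>The product rule turns \<open>D y \<bullet> z\<close> into
  \<open>D (y \<bullet> z)\<close> minus \<open>y \<bullet> D z\<close>, and the latter lies in
  \<open>I\<close>; likewise on the other side.\<close>

lemma ideal_of_sum_derivation:
  assumes "ideal_of I L" "subspace L" and D: "derivation_on L D"
  shows "ideal_of {x + D y | x y. x \<in> I \<and> y \<in> I} L"
  unfolding ideal_of_def
proof (intro conjI ballI)
  interpret D: Vector_Spaces.linear scale scale D
    using D by (simp add: derivation_on_def)
  note I = ideal_of_subspace[OF assms(1)] ideal_of_subset[OF assms(1)]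
  have DL: "D x \<in> L" if "x \<in> L" for x
    using D that by (auto simp: derivation_on_def)
  have "{x + D y | x y. x \<in> I \<and> y \<in> I} = {x + y | x y. x \<in> I \<and> y \<in> D ` I}"
    by blast
  then show "subspace {x + D y | x y. x \<in> I \<and> y \<in> I}"
    using I by (simp add: subspace_sums D.subspace_image)
  show "{x + D y | x y. x \<in> I \<and> y \<in> I} \<subseteq> L"
    using I DL assms(2) by (auto intro!: subspace_add)
  fix s z assume "s \<in> {x + D y | x y. x \<in> I \<and> y \<in> I}" and z: "z \<in> L"
  then obtain x y where s: "s = x + D y" "x \<in> I" "y \<in> I"
    by blast
  have Dyz: "D (y \<bullet> z) = D y \<bullet> z + y \<bullet> D z" "D (z \<bullet> y) = D z \<bullet> y + z \<bullet> D y"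
    using D s z I by (auto simp: derivation_on_def)
  have "x \<bullet> z - y \<bullet> D z \<in> I" "z \<bullet> x - D z \<bullet> y \<in> I" "y \<bullet> z \<in> I" "z \<bullet> y \<in> I"
    using s z DL I(1)
    by (auto intro!: subspace_diff intro: ideal_of_mult_right[OF assms(1)] ideal_of_mult_left[OF assms(1)])
  moreover have "s \<bullet> z = (x \<bullet> z - y \<bullet> D z) + D (y \<bullet> z)" "z \<bullet> s = (z \<bullet> x - D z \<bullet> y) + D (z \<bullet> y)"
    by (simp_all add: s mult_add_left mult_add_right Dyz)
  ultimately show "s \<bullet> z \<in> {x + D y | x y. x \<in> I \<and> y \<in> I}"
    "z \<bullet> s \<in> {x + D y | x y. x \<in> I \<and> y \<in> I}"
    by blast+
qed

end

section \<open>Characteristic zero: derivations preserve maximal solvable ideals\<close>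

locale leibniz_algebra_char_0 = leibniz_algebra scale mult
  for scale :: "'f::field_char_0 \<Rightarrow> 'a::ab_group_add \<Rightarrow> 'a" and mult (infixl "\<bullet>" 70)
begin

text \<open>
  The factor \<open>m!\<close> of the Leibniz rule is absorbed into the choice of \<open>w\<close>; this makes the right-hand
  side a subspace, so that the induction need only consider products and not their spans.
\<close>
lemma derived_series_sum_derivation:
  assumes I: "ideal_of I L" and subL: "subspace L" and D: "derivation_on L D"
  shows "derived_series {x + D y | x y. x \<in> I \<and> y \<in> I} n \<subseteq>
    {z. \<exists>w\<in>derived_series I n. (\<forall>k<2 ^ n. (D ^^ k) w \<in> I) \<and> (D ^^ (2 ^ n)) w - z \<in> I}"
    (is "?X n \<subseteq> ?T n")
proof -
  note subI = ideal_of_subspace[OF I] and IL = ideal_of_subset[OF I]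
  have subT: "subspace (?T k)" for k
  proof (rule subspaceI)
    interpret Dm: Vector_Spaces.linear scale scale "D ^^ m" for m
      using D by (auto simp: derivation_on_def intro: linear_funpow)
    note V = subspace_derived_series[OF subI, of k]
    show "0 \<in> ?T k"
      using V subI by (auto intro!: bexI[of _ 0] intro: subspace_0 simp: Dm.zero)
    fix y assume "y \<in> ?T k"
    then obtain v where v: "v \<in> derived_series I k" "\<forall>i<2 ^ k. (D ^^ i) v \<in> I"
        "(D ^^ (2 ^ k)) v - y \<in> I"
      by blast
    show "scale c y \<in> ?T k" for c
      using v subspace_scale[OF V v(1)] subspace_scale[OF subI]
      by (auto intro!: bexI[of _ "scale c v"] simp: Dm.scale simp flip: scale_right_diff_distrib)
    fix x assume "x \<in> ?T k"
    then obtain u where u: "u \<in> derived_series I k" "\<forall>i<2 ^ k. (D ^^ i) u \<in> I"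
        "(D ^^ (2 ^ k)) u - x \<in> I"
      by blast
    show "x + y \<in> ?T k"
      using u v subspace_add[OF V u(1) v(1)] subspace_add[OF subI] subspace_add[OF subI u(3) v(3)]
      by (auto intro!: bexI[of _ "u + v"] simp: Dm.add algebra_simps)
  qed
  show ?thesis
  proof (induction n)
    case 0
    show ?case
    proof
      fix z assume "z \<in> ?X 0"
      then obtain x y where "z = x + D y" "x \<in> I" "y \<in> I"
        by auto
      \<comment> \<open>The witness is \<open>y\<close>, as \<open>D y - z = - x\<close>.\<close>
      then show "z \<in> ?T 0"
        using subspace_neg[OF subI, of x] by (auto intro!: bexI[of _ y])
    qed
  next
    case (Suc n)
    show ?case
      unfolding derived_series.simps(2)[of "{x + D y | x y. x \<in> I \<and> y \<in> I}"]
    proof (rule product_space_minimal[OF subT])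
      fix x y assume "x \<in> ?X n" "y \<in> ?X n"
      define m :: nat where "m = 2 ^ n"
      have "x \<in> ?T n" "y \<in> ?T n"
        using Suc \<open>x \<in> ?X n\<close> \<open>y \<in> ?X n\<close> by blast+
      then obtain u v where u: "u \<in> derived_series I n" "\<And>k. k < m \<Longrightarrow> (D ^^ k) u \<in> I"
          "(D ^^ m) u - x \<in> I"
        and v: "v \<in> derived_series I n" "\<And>k. k < m \<Longrightarrow> (D ^^ k) v \<in> I" "(D ^^ m) v - y \<in> I"
        unfolding m_def by blast
      have uvI: "u \<in> I" "v \<in> I"
        using u(2)[of 0] v(2)[of 0] by (auto simp: m_def)
      then have uvL: "(D ^^ k) u \<in> L" "(D ^^ k) v \<in> L" for k
        using IL derivation_on_funpow_closed[OF D] by blast+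
      have "x \<in> L"
        using subspace_diff[OF subL uvL(1)[of m], of "(D ^^ m) u - x"] u(3) IL by auto
      note expand = derivation_on_funpow_mult[OF D, of u v]
      let ?f = "\<lambda>N k. scale (of_nat (N choose k)) ((D ^^ k) u \<bullet> (D ^^ (N - k)) v)"
      \<comment> \<open>One factor is a derivative of order below \<open>m\<close>, hence in
        \<open>I\<close>; the other lies in \<open>L\<close>.\<close>
      have f: "?f N k \<in> I" if "k < m \<or> N - k < m" for N k
        using that u(2) v(2) uvL ideal_of_mult_left[OF I] ideal_of_mult_right[OF I]
        by (intro subspace_scale[OF subI]) blast
      \<comment> \<open>The coefficient of the middle term of the Leibniz rule, nonzero in
        characteristic zero. These central binomials build up the factor \<open>m!\<close>.\<close>
      define c :: 'f where "c = of_nat (2 * m choose m)"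
      have "c \<noteq> 0"
        by (simp add: c_def)
      \<comment> \<open>Two orders with sum below \<open>2 * m\<close> cannot both reach
        \<open>m\<close>.\<close>
      have low: "(D ^^ k) (u \<bullet> v) \<in> I" if "k < 2 * m" for k
        using that uvI IL by (subst expand) (auto intro!: subspace_sum[OF subI] f)
      have "(D ^^ (2 * m)) (u \<bullet> v) = (\<Sum>k\<le>2 * m. ?f (2 * m) k)"
        using uvI IL by (intro expand) auto
      \<comment> \<open>Off the middle, one of the two orders is below \<open>m\<close>, so every
        other term lies in \<open>I\<close>.\<close>
      also have "\<dots> = ?f (2 * m) m + (\<Sum>k\<in>{..2 * m} - {m}. ?f (2 * m) k)"
        by (rule sum.remove) auto
      also have "?f (2 * m) m = scale c ((D ^^ m) u \<bullet> (D ^^ m) v)"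
        by (simp add: c_def mult_2)
      finally have "(D ^^ (2 * m)) (u \<bullet> v) - scale c ((D ^^ m) u \<bullet> (D ^^ m) v) \<in> I"
        by (auto intro!: subspace_sum[OF subI] f)
      \<comment> \<open>This telescopes to the difference of
        \<open>(D ^^ m) u \<bullet> (D ^^ m) v\<close> and \<open>x \<bullet> y\<close>.\<close>
      moreover have "((D ^^ m) u - x) \<bullet> (D ^^ m) v + x \<bullet> ((D ^^ m) v - y) \<in> I"
        using u(3) v(3) uvL \<open>x \<in> L\<close>
        by (intro subspace_add[OF subI] ideal_of_mult_left[OF I] ideal_of_mult_right[OF I])
      then have "scale c ((D ^^ m) u \<bullet> (D ^^ m) v - x \<bullet> y) \<in> I"
        by (intro subspace_scale[OF subI]) (simp add: mult_diff_left mult_diff_right)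
      ultimately have "(D ^^ (2 * m)) (u \<bullet> v) - scale c (x \<bullet> y) \<in> I"
        using subspace_add[OF subI] by (fastforce simp: scale_right_diff_distrib)
      then have "scale c (x \<bullet> y) \<in> ?T (Suc n)"
        using low mult_in_product_space[OF u(1) v(1)]
        by (auto intro!: bexI[of _ "u \<bullet> v"] simp: m_def)
      from subspace_scale[OF subT this, of "inverse c"] show "x \<bullet> y \<in> ?T (Suc n)"
        using \<open>c \<noteq> 0\<close> by simp
    qed
  qed
qed

lemma maximal_solvable_ideal_derivation:
  assumes R: "ideal_of R L" "solvable R" and L: "subspace L" and D: "derivation_on L D"
    and max: "\<And>J. ideal_of J L \<Longrightarrow> solvable J \<Longrightarrow> R \<subseteq> J \<Longrightarrow> J = R"
  shows "D ` R \<subseteq> R"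
proof -
  let ?S = "{x + D y | x y. x \<in> R \<and> y \<in> R}"
  interpret D: Vector_Spaces.linear scale scale D
    using D by (simp add: derivation_on_def)
  have S: "ideal_of ?S L"
    using ideal_of_sum_derivation R L D by blast
  obtain n where n: "derived_series R n = {0}"
    using R by (auto simp: solvable_def)
  interpret Dn: Vector_Spaces.linear scale scale "D ^^ (2 ^ n)"
    using D by (auto simp: derivation_on_def intro: linear_funpow)
  \<comment> \<open>Only \<open>w = 0\<close> is available at stage \<open>n\<close>, so the
    condition on \<open>z\<close> reduces to \<open>- z \<in> R\<close>.\<close>
  have "derived_series ?S n \<subseteq> R"
    using derived_series_sum_derivation[OF R(1) L D, of n] subspace_neg[OF ideal_of_subspace[OF R(1)]]
    by (fastforce simp: n Dn.zero)
  then have "solvable ?S"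
    using S R by (blast intro: solvable_extension ideal_of_subspace)
  moreover have "0 \<in> R"
    using R(1) by (intro subspace_0 ideal_of_subspace)
  then have "R \<subseteq> ?S" "D ` R \<subseteq> ?S"
    by (force simp: D.zero)+
  ultimately show ?thesis
    using max[OF S] by blast
qed

section \<open>From ideals of an ideal up the subinvariant chain\<close>

lemma anticommutator_mult_eq_0: "(x \<bullet> y + y \<bullet> x) \<bullet> z = 0"
  \<comment> \<open>Adding the two identities cancels \<open>x \<bullet> (y \<bullet> z)\<close> and
    \<open>y \<bullet> (x \<bullet> z)\<close>.\<close>
  using leibniz[of x y z] leibniz[of y x z] by (simp add: mult_add_left algebra_simps)

lemma maximal_solvable_ideal_of_ideal:
  assumes R: "ideal_of R L" "solvable R" and L: "ideal_of L M"
    and max: "\<And>J. ideal_of J L \<Longrightarrow> solvable J \<Longrightarrow> R \<subseteq> J \<Longrightarrow> J = R"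
  shows "ideal_of R M"
proof -
  have subL: "subspace L"
    using L by (rule ideal_of_subspace)
  let ?K = "{x \<in> L. \<forall>z. x \<bullet> z = 0}"
  have K: "subspace ?K"
    using subL by (auto simp: subspace_def mult_add_left mult_scale_left)
  \<comment> \<open>Here \<open>x \<bullet> y = 0\<close>, so the anticommutator is just
    \<open>y \<bullet> x\<close>; hence \<open>?K\<close> absorbs left multiplication.\<close>
  have "y \<bullet> x \<bullet> z = 0" if "x \<in> ?K" for x y z
    using anticommutator_mult_eq_0[of x y z] that by simp
  then have "ideal_of ?K L"
    using K subL L unfolding ideal_of_def by (auto intro: subspace_0)
  moreover have "product_space ?K ?K \<subseteq> {0}"
    by (rule product_space_minimal) (auto simp: subspace_def)
  then have "derived_series ?K 1 = {0}"
    using subspace_0[OF subspace_product_space, of ?K ?K] by auto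
  then have "solvable ?K"
    unfolding solvable_def by blast
  ultimately have KR: "?K \<subseteq> R"
    using maximal_solvable_ideal_contains[OF R subL max] by blast
  have left: "y \<bullet> x \<in> R" if "x \<in> R" "y \<in> M" for x y
  proof -
    have "derivation_on L ((\<bullet>) y)"
      using L that leibniz[of y] linear_right[of y]
      by (auto simp: derivation_on_def intro: ideal_of_mult_left)
    then show ?thesis
      using maximal_solvable_ideal_derivation[OF R subL _ max] that by blast
  qed
  have right: "x \<bullet> y \<in> R" if "x \<in> R" "y \<in> M" for x y
  proof -
    have "x \<in> L"
      using that ideal_of_subset[OF R(1)] by blast
    then have "x \<bullet> y + y \<bullet> x \<in> ?K"
      using that L subL anticommutator_mult_eq_0
      by (auto intro!: subspace_add intro: ideal_of_mult_left ideal_of_mult_right)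
    then have "(x \<bullet> y + y \<bullet> x) - y \<bullet> x \<in> R"
      using KR left[OF that] by (blast intro: subspace_diff ideal_of_subspace[OF R(1)])
    then show ?thesis
      by simp
  qed
  show ?thesis
    using left right R L unfolding ideal_of_def by blast
qed

lemma solvable_subinvariant_subset_rad:
  assumes "solvable S" "subinvariant S"
  shows "S \<subseteq> rad"
proof -
  obtain t :: nat and C where C: "C t = S" "C 0 = UNIV" "\<And>i. i \<le> t \<Longrightarrow> subalgebra (C i)"
    "\<And>i. i \<in> {1..t} \<Longrightarrow> ideal_of (C i) (C (i - 1))"
    using assms(2) unfolding subinvariant_def by blast
  have "\<exists>I. ideal_of I (C 0) \<and> solvable I \<and> S \<subseteq> I"
  \<comment> \<open>The index descends from \<open>t\<close>, where \<open>S\<close> is an ideal of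
    itself. Each step enlarges the ideal to a maximal solvable one, which remains an ideal one level
    up.\<close>
  proof (rule inc_induct[of 0 t])
    show "\<exists>I. ideal_of I (C t) \<and> solvable I \<and> S \<subseteq> I"
      using C(1) C(3)[of t] assms(1) by (auto simp: ideal_of_def subalgebra_def)
    fix i assume i: "i < t" and "\<exists>I. ideal_of I (C (Suc i)) \<and> solvable I \<and> S \<subseteq> I"
    then obtain I where I: "ideal_of I (C (Suc i))" "solvable I" "S \<subseteq> I"
      by blast
    obtain R where R: "ideal_of R (C (Suc i))" "solvable R" "I \<subseteq> R"
      "\<And>J. ideal_of J (C (Suc i)) \<Longrightarrow> solvable J \<Longrightarrow> R \<subseteq> J \<Longrightarrow> J = R"
      using exists_maximal_solvable_ideal[OF I(1,2)] by metis
    have "ideal_of R (C i)"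
      using maximal_solvable_ideal_of_ideal[OF R(1,2) _ R(4)] C(4)[of "Suc i"] i by simp
    then show "\<exists>I. ideal_of I (C i) \<and> solvable I \<and> S \<subseteq> I"
      using R I by blast
  qed simp
  then show ?thesis
    using solvable_ideal_subset_rad by (auto simp: C(2))
qed

end

theorem theorem3p6:
  fixes scale :: "'f::field_char_0 \<Rightarrow> 'a::ab_group_add \<Rightarrow> 'a"
    and mult :: "'a \<Rightarrow> 'a \<Rightarrow> 'a"
    and S :: "'a set"
  assumes "leibniz_algebra scale mult"
    and "leibniz_algebra.subalgebra scale mult S"
    and "leibniz_algebra.solvable scale mult S"
    and "leibniz_algebra.subinvariant scale mult S"
  shows "S \<subseteq> leibniz_algebra.rad scale mult"
proof -
  interpret leibniz_algebra scale mult
    by fact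
  interpret leibniz_algebra_char_0 scale mult
    by unfold_locales
  show ?thesis
    using assms by (intro solvable_subinvariant_subset_rad)
qed

end
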